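(* Let $p$ be a prime, $m\ge 1$ an integer, and $\ell$ an integer not divisible by $p$; if $(p,m)=(3,1)$, assume in addition that $\ell\equiv 1\mod 3$. Let $\alpha=1+p^m\ell$ and let $J$, $A$, $B$, $C$, $\phi$, $\varphi$ be as defined in the context. For all $n,t\in\mathbb{Z}$ the following identities hold in $J$: $$[C^n,A^t]=A^{-p^m\ell nt-p^{2m}\ell^2\phi(n)t},$$ $$[C^n,B^t]=B^{p^m\ell nt-p^{2m}\ell^2\phi(n+1)t},$$ $$[A^n,B^t]=A^{-p^m\ell\phi(n)t}\,B^{p^m\ell n\phi(t)}\,C^{nt-p^m\ell\phi(n)\phi(t)}\,A^{\xi(n,t)},$$ where $$\xi(n,t)=p^{2m}\ell^2\chi_p\{2\varphi(n+1)t+(2n-7)\phi(n)\phi(t)-2n\phi(t)-(3n+1)n\varphi(t)-2\delta_{p,3}3^{m-1}\ell\phi(n)\phi(t)\},$$ with $\delta_{p,3}=1$ if $p=3$ and $\delta_{p,3}=0$ if $p\ne 3$, and $\chi_p=1/2$ if $p=2$ and $\chi_p=(1+p^m)/2$ if $p\neq 2$.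
   Context: Notation: $[a,b]=a^{-1}b^{-1}ab$, $b^a=a^{-1}ba$. The group $J$ is the Sylow $p$-subgroup of the finite nilpotent Macdonald group $\langle x,y\mid x^{[x,y]}=x^\alpha,\ y^{[y,x]}=y^\alpha\rangle$, and it has the presentation $$J=\langle A,B\mid A^{[A,B]}=A^\alpha,\ B^{[B,A]}=B^\alpha,\ A^{2^{3m-1}}=1=B^{2^{3m-1}}\rangle\quad\text{if }p=2,$$ $$J=\langle A,B\mid A^{[A,B]}=A^\alpha,\ B^{[B,A]}=B^\alpha,\ A^{p^{3m}}=1=B^{p^{3m}}\rangle\quad\text{if }p\ne 2.$$ In either case $C=[A,B]$. For $n\in\mathbb{Z}$, $\phi(n)=\frac{(n-1)n}{2}$ and $\varphi(n)=\frac{n(n-1)(n-2)}{6}$. *)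

theory Defs
  imports Complex_Main "HOL-Algebra.Coset" "HOL-Number_Theory.Cong"
begin

text \<open>The free group on the type \<open>'a\<close>, realised on reduced words: the letter \<open>(x, True)\<close>
  stands for the generator \<open>x\<close> and \<open>(x, False)\<close> for its inverse.\<close>

type_synonym 'a word = "('a \<times> bool) list"

fun letter_inv :: "'a \<times> bool \<Rightarrow> 'a \<times> bool" where
  "letter_inv (x, b) = (x, \<not> b)"

fun reduced :: "'a word \<Rightarrow> bool" where
  "reduced (x # y # w) \<longleftrightarrow> y \<noteq> letter_inv x \<and> reduced (y # w)"
| "reduced _ \<longleftrightarrow> True"

fun push_letter :: "'a \<times> bool \<Rightarrow> 'a word \<Rightarrow> 'a word" where
  "push_letter x [] = [x]"
| "push_letter x (y # w) = (if y = letter_inv x then w else x # y # w)"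

definition free_group :: "'a word monoid" where
  "free_group = \<lparr>carrier = {w. reduced w}, monoid.mult = (\<lambda>u v. foldr push_letter u v), one = []\<rparr>"

definition free_gen :: "'a \<Rightarrow> 'a word" where
  "free_gen x = [(x, True)]"

lemma letter_inv_letter_inv [simp]: "letter_inv (letter_inv x) = x"
  by (cases x) simp

lemma letter_inv_neq [simp]: "letter_inv x \<noteq> x"
  by (cases x) simp

lemma reduced_Cons: "reduced (x # w) \<longleftrightarrow> reduced w \<and> (\<forall>y v. w = y # v \<longrightarrow> y \<noteq> letter_inv x)"
  by (cases w) auto

lemma reduced_push_letter: "reduced w \<Longrightarrow> reduced (push_letter x w)"
  by (cases w) (auto simp: reduced_Cons)

lemma reduced_foldr_push: "reduced v \<Longrightarrow> reduced (foldr push_letter u v)"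
  by (induction u) (auto intro: reduced_push_letter)

lemma push_letter_cancel: "reduced w \<Longrightarrow> push_letter x (push_letter (letter_inv x) w) = w"
  by (cases w; cases "tl w") (auto simp: reduced_Cons)

lemma foldr_push_push:
  "reduced w \<Longrightarrow> foldr push_letter (push_letter x v) w = push_letter x (foldr push_letter v w)"
  by (cases v) (auto simp: push_letter_cancel reduced_foldr_push)

lemma foldr_push_assoc:
  "reduced w \<Longrightarrow>
    foldr push_letter (foldr push_letter u v) w = foldr push_letter u (foldr push_letter v w)"
  by (induction u) (auto simp: foldr_push_push)

lemma foldr_push_Nil: "reduced u \<Longrightarrow> foldr push_letter u [] = u"
proof (induction u)
  case (Cons x u)
  then show ?case by (cases u) auto
qed simp

lemma foldr_push_inverse:
  "reduced w \<Longrightarrow> foldr push_letter (map letter_inv (rev u)) (foldr push_letter u w) = w"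
proof (induction u)
  case (Cons x u)
  then show ?case
    using push_letter_cancel[of "foldr push_letter u w" "letter_inv x"]
    by (simp add: reduced_foldr_push)
qed simp

lemma group_free_group: "group (free_group :: 'a word monoid)"
proof (rule groupI)
  fix u :: "'a word"
  assume "u \<in> carrier free_group"
  then have u: "reduced u" by (simp add: free_group_def)
  let ?v = "foldr push_letter (map letter_inv (rev u)) []"
  have "reduced ?v" by (rule reduced_foldr_push) simp
  moreover have "foldr push_letter ?v u = []"
    using foldr_push_assoc[OF u] foldr_push_inverse[of "[]" u] u by (simp add: foldr_push_Nil)
  ultimately show "\<exists>v \<in> carrier free_group. v \<otimes>\<^bsub>free_group\<^esub> u = \<one>\<^bsub>free_group\<^esub>"
    by (auto simp: free_group_def)
qed (auto simp: free_group_def reduced_foldr_push foldr_push_assoc)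

lemma free_gen_closed: "free_gen x \<in> carrier free_group"
  by (simp add: free_gen_def free_group_def)

definition normal_closure :: "('a, 'b) monoid_scheme \<Rightarrow> 'a set \<Rightarrow> 'a set" where
  "normal_closure G R = \<Inter>{N. N \<lhd> G \<and> R \<subseteq> N}"

lemma (in group) normal_closure_normal:
  assumes "R \<subseteq> carrier G"
  shows "normal_closure G R \<lhd> G"
proof -
  let ?S = "{N. N \<lhd> G \<and> R \<subseteq> N}"
  have "carrier G \<lhd> G" by (auto simp: normal_inv_iff subgroup_self)
  then have "carrier G \<in> ?S" using assms by simp
  then have "subgroup (\<Inter>?S) G"
    by (intro subgroups_Inter) (auto intro: normal_imp_subgroup)
  moreover have "x \<otimes> h \<otimes> inv x \<in> \<Inter>?S" if "x \<in> carrier G" "h \<in> \<Inter>?S" for x h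
    using that by (auto intro: normal.inv_op_closed2)
  ultimately show ?thesis
    unfolding normal_closure_def by (simp add: normal_inv_iff)
qed

text \<open>The group with generators \<open>'a\<close> and defining relations \<open>u = v\<close> for \<open>(u, v) \<in> E\<close>.\<close>

definition relators :: "('a word \<times> 'a word) set \<Rightarrow> 'a word set" where
  "relators E = {u \<otimes>\<^bsub>free_group\<^esub> inv\<^bsub>free_group\<^esub> v |u v. (u, v) \<in> E}"

definition presented_group :: "('a word \<times> 'a word) set \<Rightarrow> 'a word set monoid" where
  "presented_group E = free_group Mod normal_closure free_group (relators E)"

definition presented_gen :: "('a word \<times> 'a word) set \<Rightarrow> 'a \<Rightarrow> 'a word set" where
  "presented_gen E x = normal_closure free_group (relators E) #>\<^bsub>free_group\<^esub> free_gen x"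

lemma normal_closure_relators:
  assumes "\<And>u v. (u, v) \<in> E \<Longrightarrow> u \<in> carrier free_group \<and> v \<in> carrier free_group"
  shows "normal_closure free_group (relators E) \<lhd> free_group"
proof -
  interpret group "free_group :: 'a word monoid" by (rule group_free_group)
  show ?thesis
    using assms by (intro normal_closure_normal) (fastforce simp: relators_def)
qed

lemma group_presented_group:
  assumes "\<And>u v. (u, v) \<in> E \<Longrightarrow> u \<in> carrier free_group \<and> v \<in> carrier free_group"
  shows "group (presented_group E)"
  unfolding presented_group_def
  by (rule normal.factorgroup_is_group[OF normal_closure_relators[OF assms]])

definition commutator :: "('a, 'b) monoid_scheme \<Rightarrow> 'a \<Rightarrow> 'a \<Rightarrow> 'a" where
  "commutator G a b = inv\<^bsub>G\<^esub> a \<otimes>\<^bsub>G\<^esub> inv\<^bsub>G\<^esub> b \<otimes>\<^bsub>G\<^esub> a \<otimes>\<^bsub>G\<^esub> b"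

text \<open>\<open>conjugate G b a\<close> is \<open>b\<^sup>a = a\<^sup>-\<^sup>1 b a\<close>.\<close>

definition conjugate :: "('a, 'b) monoid_scheme \<Rightarrow> 'a \<Rightarrow> 'a \<Rightarrow> 'a" where
  "conjugate G b a = inv\<^bsub>G\<^esub> a \<otimes>\<^bsub>G\<^esub> b \<otimes>\<^bsub>G\<^esub> a"

datatype gen = GenA | GenB

definition J_exponent :: "nat \<Rightarrow> nat \<Rightarrow> nat" where
  "J_exponent p m = (if p = 2 then 2 ^ (3 * m - 1) else p ^ (3 * m))"

definition J_relations :: "nat \<Rightarrow> nat \<Rightarrow> int \<Rightarrow> (gen word \<times> gen word) set" where
  "J_relations p m \<alpha> =
    (let F = free_group; a = free_gen GenA; b = free_gen GenB in
      {(conjugate F a (commutator F a b), a [^]\<^bsub>F\<^esub> \<alpha>),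
       (conjugate F b (commutator F b a), b [^]\<^bsub>F\<^esub> \<alpha>),
       (a [^]\<^bsub>F\<^esub> J_exponent p m, \<one>\<^bsub>F\<^esub>),
       (b [^]\<^bsub>F\<^esub> J_exponent p m, \<one>\<^bsub>F\<^esub>)})"

definition J_group :: "nat \<Rightarrow> nat \<Rightarrow> int \<Rightarrow> gen word set monoid" where
  "J_group p m \<alpha> = presented_group (J_relations p m \<alpha>)"

definition J_A :: "nat \<Rightarrow> nat \<Rightarrow> int \<Rightarrow> gen word set" where
  "J_A p m \<alpha> = presented_gen (J_relations p m \<alpha>) GenA"

definition J_B :: "nat \<Rightarrow> nat \<Rightarrow> int \<Rightarrow> gen word set" where
  "J_B p m \<alpha> = presented_gen (J_relations p m \<alpha>) GenB"

definition J_C :: "nat \<Rightarrow> nat \<Rightarrow> int \<Rightarrow> gen word set" where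
  "J_C p m \<alpha> = commutator (J_group p m \<alpha>) (J_A p m \<alpha>) (J_B p m \<alpha>)"

lemma J_relations_closed:
  assumes "(u, v) \<in> J_relations p m \<alpha>"
  shows "u \<in> carrier free_group \<and> v \<in> carrier free_group"
proof -
  interpret group "free_group :: gen word monoid" by (rule group_free_group)
  show ?thesis
    using assms
    by (auto simp: J_relations_def Let_def conjugate_def commutator_def free_gen_closed)
qed

lemma group_J_group: "group (J_group p m \<alpha>)"
  unfolding J_group_def by (rule group_presented_group) (rule J_relations_closed)

text \<open>The divisions in \<open>phi\<close> and \<open>varphi\<close> are exact, and \<open>xi\<close>, although written with the
  rational number \<open>chi p m\<close>, is integral; \<open>\<lfloor>xi p m l n t\<rfloor>\<close> is thus \<open>xi p m l n t\<close> itself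
  read as an integer exponent.\<close>

definition phi :: "int \<Rightarrow> int" where
  "phi n = (n - 1) * n div 2"

definition varphi :: "int \<Rightarrow> int" where
  "varphi n = n * (n - 1) * (n - 2) div 6"

definition chi :: "nat \<Rightarrow> nat \<Rightarrow> rat" where
  "chi p m = (if p = 2 then 1 / 2 else (1 + of_nat p ^ m) / 2)"

definition delta3 :: "nat \<Rightarrow> int" where
  "delta3 p = (if p = 3 then 1 else 0)"

definition xi :: "nat \<Rightarrow> nat \<Rightarrow> int \<Rightarrow> int \<Rightarrow> int \<Rightarrow> rat" where
  "xi p m l n t =
    of_nat p ^ (2 * m) * of_int l ^ 2 * chi p m *
    of_int (2 * varphi (n + 1) * t + (2 * n - 7) * phi n * phi t - 2 * n * phi t
      - (3 * n + 1) * n * varphi t - 2 * delta3 p * 3 ^ (m - 1) * l * phi n * phi t)"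

lemma of_int_phi: "of_int (phi n) = ((of_int n - 1) * of_int n / 2 :: rat)"
proof -
  have "2 * phi n = (n - 1) * n" by (simp add: phi_def)
  then have "of_int (2 * phi n) = (of_int ((n - 1) * n) :: rat)" by simp
  then show ?thesis by simp
qed

lemma of_int_varphi:
  "of_int (varphi n) = (of_int n * (of_int n - 1) * (of_int n - 2) / 6 :: rat)"
proof -
  have "[n * (n - 1) * (n - 2) = (n mod 6) * (n mod 6 - 1) * (n mod 6 - 2)] (mod 6)"
    by (intro cong_mult cong_diff cong_refl) (simp_all add: cong_def)
  moreover have "n mod 6 \<in> {0, 1, 2, 3, 4, 5}" by auto
  ultimately have "6 dvd n * (n - 1) * (n - 2)" by (auto simp: cong_def)
  then have "6 * varphi n = n * (n - 1) * (n - 2)"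
    by (simp add: varphi_def)
  then have "of_int (6 * varphi n) = (of_int (n * (n - 1) * (n - 2)) :: rat)" by simp
  then show ?thesis by simp
qed

lemma of_int_floor_xi:
  assumes "prime p" "m \<ge> 1"
  shows "of_int \<lfloor>xi p m l n t\<rfloor> = xi p m l n t"
proof -
  have "of_nat p ^ (2 * m) * chi p m \<in> \<int>"
  proof (cases "p = 2")
    case True
    obtain k where k: "2 * m = Suc k" using assms(2) by (cases m) auto
    have "of_nat p ^ (2 * m) * chi p m = 2 ^ k"
      using True by (simp add: chi_def k)
    then show ?thesis by simp
  next
    case False
    then have "odd p" using assms(1) primes_dvd_imp_eq two_is_prime_nat by blast
    then have "even (1 + p ^ m)" by simp
    then obtain k where k: "1 + p ^ m = 2 * k" by (elim evenE)
    have "1 + of_nat p ^ m = (2 * of_nat k :: rat)"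
      by (metis k of_nat_1 of_nat_add of_nat_mult of_nat_numeral of_nat_power)
    then have "chi p m = of_nat k" using False by (simp add: chi_def)
    then show ?thesis by simp
  qed
  then have "of_nat p ^ (2 * m) * of_int l ^ 2 * chi p m * of_int z \<in> \<int>" for z
    using Ints_mult[of "of_nat p ^ (2 * m) * chi p m" "of_int l ^ 2 * of_int z"]
    by (simp add: mult_ac)
  then have "xi p m l n t \<in> \<int>"
    unfolding xi_def by blast
  then show ?thesis by (simp add: of_int_floor_cancel)
qed

end

theory Submission
  imports Defs
begin

text \<open>Write \<open>q = p\<^sup>m l\<close>, so that \<open>\<alpha> = 1 + q\<close>, and let \<open>N\<close> be the exponent imposed on \<open>A\<close> and \<open>B\<close>.
  Since \<open>N\<close> divides \<open>q\<^sup>3\<close>, the power \<open>\<alpha>\<^sup>n\<close> is \<open>1 + n q + \<phi>(n) q\<^sup>2\<close> modulo \<open>N\<close> for every integer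
  \<open>n\<close>. The defining relations say that \<open>C\<close> raises \<open>A\<close> to the power \<open>\<alpha>\<close> and that its inverse does so
  to \<open>B\<close>; iterating them (\<open>int_pow_swap\<close>) gives the first two identities.

  For the third, \<open>A\<^sup>B = A C\<close> and \<open>B\<^sup>A = B C\<^sup>-\<^sup>1\<close> by the definition of \<open>C\<close>. As \<open>C\<close> normalises the
  cyclic groups of \<open>A\<close> and \<open>B\<close>, powers of these two products can be collected (\<open>A_pow_B\<close>, \<open>B_pow_A\<close>).
  Conjugating \<open>A\<^sup>\<alpha> = A\<^sup>C\<close> by \<open>B\<close> in two ways then yields \<open>A\<^sup>-\<^sup>s = B\<^sup>s\<close> for an explicit integer \<open>s\<close>
  (\<open>A_pow_defect_eq_B\<close>). Let \<open>h = \<chi>\<^sub>p q\<^sup>2\<close>, which is half of \<open>q\<^sup>2\<close> modulo \<open>N\<close>. Modulo \<open>N\<close>, the number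
  \<open>s\<close> is \<open>h\<close> for \<open>p \<noteq> 3\<close> and \<open>h (1 - 2 q / 3)\<close> for \<open>p = 3\<close>, and the factor \<open>1 - 2 q / 3\<close> is prime to \<open>3\<close> except
  when \<open>m = 1\<close> and \<open>l\<close> is \<open>2\<close> modulo \<open>3\<close>. So \<open>A\<^sup>h = B\<^sup>-\<^sup>h\<close>, and this element is central because it
  commutes with both \<open>A\<close> and \<open>B\<close>.

  Every correction of second order in \<open>q\<close> is a power of this central element, those of third order
  vanish (except that a third of \<open>q\<^sup>3\<close> survives for \<open>p = 3\<close>), and \<open>A\<^sup>q\<close> commutes with \<open>B\<^sup>q\<close>. This makes the recursion
  \<open>[A\<^sup>n\<^sup>+\<^sup>1, B\<^sup>t] = A\<^sup>-\<^sup>1 [A\<^sup>n, B\<^sup>t] A [A, B\<^sup>t]\<close> explicit on products \<open>A\<^sup>i B\<^sup>j C\<^sup>k A\<^sup>h\<^sup>x\<close>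
  (\<open>normal_form_step\<close>). The claimed right-hand side satisfies the same recursion, which reduces to a
  polynomial identity for \<open>\<xi>\<close> (\<open>xi_factor_Suc\<close>). Each step can be undone, so both agree at
  all integers \<open>n\<close> once they agree at \<open>0\<close>.\<close>

section \<open>Exponents\<close>

text \<open>The binomial expansion of \<open>(1 + q)\<^sup>n\<close> up to second order.\<close>

definition conj_exp :: "int \<Rightarrow> int \<Rightarrow> int" where
  "conj_exp q n = 1 + n * q + phi n * q ^ 2"

text \<open>If conjugation by \<open>y\<^sup>-\<^sup>1\<close> raises \<open>x\<close> to the power \<open>(1 + q)\<^sup>-\<^sup>1\<close>, then \<open>(x y)\<^sup>n = x\<^sup>\<sigma> y\<^sup>n\<close> where
  \<open>\<sigma>\<close> is the sum of \<open>(1 + q)\<^sup>-\<^sup>i\<close> over \<open>0 \<le> i < n\<close>. The second-order expansion of \<open>n - \<sigma>\<close>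
  is a polynomial in \<open>n\<close>, hence makes sense for negative \<open>n\<close> as well.\<close>

definition pow_defect :: "int \<Rightarrow> int \<Rightarrow> int" where
  "pow_defect q n = q * phi n - q ^ 2 * (phi n + varphi n)"

lemma two_phi: "2 * phi n = n * n - n"
proof -
  have "even ((n - 1) * n)" by simp
  then show ?thesis unfolding phi_def by (simp add: algebra_simps)
qed

lemma six_varphi: "6 * varphi n = n * (n - 1) * (n - 2)"
proof -
  have "of_int (6 * varphi n) = (of_int (n * (n - 1) * (n - 2)) :: rat)"
    by (simp add: of_int_varphi)
  then show ?thesis by (simp only: of_int_eq_iff)
qed

lemma three_varphi: "3 * varphi n = phi n * (n - 2)"
proof -
  have "2 * (3 * varphi n) = 2 * phi n * (n - 2)"
    unfolding two_phi using six_varphi[of n] by (simp add: algebra_simps)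
  then show ?thesis by simp
qed

lemma phi_0 [simp]: "phi 0 = 0" and phi_1 [simp]: "phi 1 = 0"
  by (simp_all add: phi_def)

lemma varphi_0 [simp]: "varphi 0 = 0" and varphi_1 [simp]: "varphi 1 = 0"
  by (simp_all add: varphi_def)

lemma phi_add: "phi (x + y) = phi x + phi y + x * y"
  using two_phi[of "x + y"] two_phi[of x] two_phi[of y] by (simp add: algebra_simps)

lemma phi_Suc: "phi (n + 1) = phi n + n"
  by (simp add: phi_add)

lemma phi_minus: "phi (- n) = phi (n + 1)"
  using two_phi[of "- n"] two_phi[of "n + 1"] by (simp add: algebra_simps)

lemma varphi_Suc: "varphi (n + 1) = varphi n + phi n"
proof -
  have "6 * varphi (n + 1) = 6 * varphi n + 3 * (2 * phi n)"
    unfolding six_varphi two_phi by (simp add: algebra_simps)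
  then show ?thesis by simp
qed

lemma pow_defect_Suc: "n + 1 - pow_defect q (n + 1) = n - pow_defect q n + conj_exp q (- n)"
  unfolding pow_defect_def conj_exp_def phi_minus phi_Suc varphi_Suc by (simp add: algebra_simps power2_eq_square)

lemma conj_exp_Suc_cong:
  assumes "N dvd q ^ 3"
  shows "[conj_exp q n * (1 + q) = conj_exp q (n + 1)] (mod N)"
proof -
  have "conj_exp q n * (1 + q) - conj_exp q (n + 1) = phi n * q ^ 3"
    unfolding conj_exp_def phi_Suc by (simp add: algebra_simps power2_eq_square power3_eq_cube)
  then show ?thesis using assms by (simp add: cong_iff_dvd_diff)
qed

text \<open>The factor in braces of \<open>\<xi>\<close>, with \<open>d\<close> in place of \<open>\<delta> 3\<^sup>m\<^sup>-\<^sup>1 l\<close>.\<close>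

definition xi_factor :: "int \<Rightarrow> int \<Rightarrow> int \<Rightarrow> int" where
  "xi_factor d n t = 2 * varphi (n + 1) * t + (2 * n - 7) * phi n * phi t - 2 * n * phi t
      - (3 * n + 1) * n * varphi t - 2 * d * phi n * phi t"

text \<open>The summands added to \<open>xi_factor d n t\<close> are the central exponents that arise when \<open>[A\<^sup>n, B\<^sup>t]\<close> is conjugated by
  \<open>A\<close>, multiplied by \<open>[A, B\<^sup>t]\<close> and collected.\<close>

lemma xi_factor_Suc:
  "xi_factor d (n + 1) t = xi_factor d n t - 2 * (2 * varphi t + phi t) - (1 + 2 * d) * (n * phi t)
     + 2 * phi (n * t + 1) - 2 * (n * t) * phi t + 2 * phi n * phi t"
proof -
  \<comment> \<open>The difference is a combination of \<open>two_phi\<close> at \<open>n\<close>, \<open>t\<close>, \<open>n t\<close> and of \<open>three_varphi\<close> at \<open>t\<close>.\<close>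
  have "xi_factor d (n + 1) t - (xi_factor d n t - 2 * (2 * varphi t + phi t) - (1 + 2 * d) * (n * phi t)
      + 2 * phi (n * t + 1) - 2 * (n * t) * phi t + 2 * phi n * phi t) =
    t * (2 * phi n - (n * n - n)) + n * n * (2 * phi t - (t * t - t))
    - (2 * phi (n * t) - (n * t * (n * t) - n * t)) + 2 * n * (phi t * (t - 2) - 3 * varphi t)"
    unfolding xi_factor_def varphi_Suc phi_Suc by (simp add: algebra_simps)
  also have "\<dots> = 0" unfolding two_phi three_varphi by simp
  finally show ?thesis by simp
qed

text \<open>Group recursions can be run backwards by cancellation, so the step is an equivalence and covers
  negative integers at no extra cost.\<close>

lemma int_eq_by_step:
  fixes f g :: "int \<Rightarrow> 'b"
  assumes "f 0 = g 0" and "\<And>n. f (n + 1) = g (n + 1) \<longleftrightarrow> f n = g n"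
  shows "f n = g n"
proof (induction n rule: int_induct[where k = 0])
  case (step2 i)
  then show ?case using assms(2)[of "i - 1"] by simp
qed (use assms in auto)

section \<open>Collecting powers in a group\<close>

context group
begin

lemma int_pow_cong:
  assumes x: "x \<in> carrier G" and "x [^] N = \<one>" and "[i = j] (mod (N :: int))"
  shows "x [^] i = x [^] j"
proof -
  obtain k where "j = i + N * k" using assms(3) by (metis cong_iff_lin)
  moreover have "x [^] (N * k) = \<one>" using assms by (simp flip: int_pow_pow)
  ultimately show ?thesis using int_pow_mult[OF x, of i "N * k"] x by simp
qed

text \<open>Turns a commutation rule into one that applies inside right-nested products.\<close>

lemma mult_eq_left_assoc:
  assumes "x \<otimes> y = u \<otimes> v" "x \<in> carrier G" "y \<in> carrier G" "u \<in> carrier G" "v \<in> carrier G"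
    "r \<in> carrier G"
  shows "x \<otimes> (y \<otimes> r) = u \<otimes> (v \<otimes> r)"
  using assms by (metis m_assoc)

lemma cancel_inv:
  assumes "x \<in> carrier G" "y \<in> carrier G"
  shows "x \<otimes> (inv x \<otimes> y) = y" "inv x \<otimes> (x \<otimes> y) = y"
  using assms by (simp_all flip: m_assoc)

lemma int_pow_Suc:
  "x \<in> carrier G \<Longrightarrow> x [^] (n + 1 :: int) = x [^] n \<otimes> x"
  by (simp add: int_pow_mult)

lemma conj_int_pow:
  assumes "x \<in> carrier G" "g \<in> carrier G"
  shows "(inv g \<otimes> x \<otimes> g) [^] (i :: int) = inv g \<otimes> x [^] i \<otimes> g"
proof (rule int_eq_by_step[where n = i])
  fix i :: int
  have "inv g \<otimes> x [^] (i + 1) \<otimes> g = (inv g \<otimes> x [^] i \<otimes> g) \<otimes> (inv g \<otimes> x \<otimes> g)"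
    using assms by (simp add: int_pow_Suc m_assoc cancel_inv)
  then show "((inv g \<otimes> x \<otimes> g) [^] (i + 1) = inv g \<otimes> x [^] (i + 1) \<otimes> g) =
      ((inv g \<otimes> x \<otimes> g) [^] i = inv g \<otimes> x [^] i \<otimes> g)"
    using assms by (simp add: int_pow_Suc)
qed (use assms in simp)

lemma int_pow_swap:
  assumes x: "x \<in> carrier G" and g: "g \<in> carrier G" and N: "x [^] N = \<one>" "N dvd q ^ 3"
    and conj: "inv g \<otimes> x \<otimes> g = x [^] (1 + q)"
  shows "x [^] t \<otimes> g [^] n = g [^] n \<otimes> x [^] (t * conj_exp q n)"
proof (rule int_eq_by_step[where n = n])
  show "x [^] t \<otimes> g [^] (0 :: int) = g [^] (0 :: int) \<otimes> x [^] (t * conj_exp q 0)"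
    using x by (simp add: conj_exp_def)
  have step: "x [^] i \<otimes> g = g \<otimes> x [^] (i * (1 + q))" for i
  proof -
    have "inv g \<otimes> x [^] i \<otimes> g = x [^] (i * (1 + q))"
      using conj_int_pow[OF x g, of i] conj x by (simp add: int_pow_pow mult.commute)
    then show ?thesis using x g by (metis inv_closed int_pow_closed inv_solve_left m_assoc m_closed)
  qed
  fix n :: int
  have "g [^] (n + 1) \<otimes> x [^] (t * conj_exp q (n + 1)) = g [^] n \<otimes> (g \<otimes> x [^] (t * conj_exp q n * (1 + q)))"
    using x g int_pow_cong[OF x N(1) cong_scalar_left[OF conj_exp_Suc_cong[OF N(2)], of t n]]
    by (simp add: int_pow_Suc m_assoc mult.assoc)
  also have "\<dots> = g [^] n \<otimes> x [^] (t * conj_exp q n) \<otimes> g"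
    using x g by (simp add: step[symmetric] m_assoc)
  finally show "(x [^] t \<otimes> g [^] (n + 1) = g [^] (n + 1) \<otimes> x [^] (t * conj_exp q (n + 1))) =
      (x [^] t \<otimes> g [^] n = g [^] n \<otimes> x [^] (t * conj_exp q n))"
    using x g by (simp add: int_pow_Suc m_assoc[symmetric])
qed

lemma int_pow_mult_swap:
  assumes x: "x \<in> carrier G" and y: "y \<in> carrier G"
    and swap: "\<And>n. y [^] n \<otimes> x = x [^] conj_exp q (- n) \<otimes> y [^] n"
  shows "(x \<otimes> y) [^] n = x [^] (n - pow_defect q n) \<otimes> y [^] n"
proof (rule int_eq_by_step[where n = n])
  show "(x \<otimes> y) [^] (0 :: int) = x [^] (0 - pow_defect q 0) \<otimes> y [^] (0 :: int)" by (simp add: pow_defect_def)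
  fix n :: int
  have "x [^] (n + 1 - pow_defect q (n + 1)) \<otimes> y [^] (n + 1) =
      x [^] (n - pow_defect q n) \<otimes> (x [^] conj_exp q (- n) \<otimes> y [^] n) \<otimes> y"
    unfolding pow_defect_Suc using x y by (simp add: int_pow_mult m_assoc)
  also have "\<dots> = x [^] (n - pow_defect q n) \<otimes> y [^] n \<otimes> (x \<otimes> y)"
    unfolding swap[symmetric] using x y by (simp add: m_assoc)
  finally show "((x \<otimes> y) [^] (n + 1) = x [^] (n + 1 - pow_defect q (n + 1)) \<otimes> y [^] (n + 1)) =
      ((x \<otimes> y) [^] n = x [^] (n - pow_defect q n) \<otimes> y [^] n)"
    using x y by (simp add: int_pow_Suc)
qed

end

section \<open>The relations of a Macdonald pair\<close>

text \<open>The relations of \<open>J\<close> together with the only arithmetic of \<open>p\<close>, \<open>m\<close> and \<open>l\<close> that the computation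
  uses, which treats all primes alike: \<open>h\<close> is half of \<open>q\<^sup>2\<close> modulo \<open>N\<close>, and \<open>d\<close> is \<open>q / 3\<close> for
  \<open>p = 3\<close> and \<open>0\<close> otherwise, which accounts for the denominator \<open>3\<close> of the cubic binomial coefficient.\<close>

locale macdonald_pair = group G for G (structure) +
  fixes A B C and q N h d :: int
  assumes A [simp]: "A \<in> carrier G" and B [simp]: "B \<in> carrier G"
    and C_def: "C = inv A \<otimes> inv B \<otimes> A \<otimes> B"
    and A_exp: "A [^] N = \<one>" and B_exp: "B [^] N = \<one>"
    and A_conj: "inv C \<otimes> A \<otimes> C = A [^] (1 + q)"
    and B_conj: "C \<otimes> B \<otimes> inv C = B [^] (1 + q)"
    and q2: "[q ^ 2 = 2 * h] (mod N)" and hq: "N dvd h * q"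
    and q_phi: "[q * phi (q * x) = - (h * x)] (mod N)"
    and q2_varphi: "[q ^ 2 * varphi (q * x) = 2 * h * d * x] (mod N)"
    and ex_unit: "\<exists>r. [h * (1 - 2 * d) * r = h] (mod N)"
begin

lemma N_dvd_q3: "N dvd q ^ 3"
proof -
  have "q ^ 3 = q * (q ^ 2 - 2 * h) + 2 * (h * q)"
    by (simp add: power2_eq_square power3_eq_cube algebra_simps)
  then show ?thesis using q2 hq by (simp add: cong_iff_dvd_diff)
qed

lemma N_dvd_q2_phi: "N dvd q ^ 2 * phi (q * x)"
proof -
  have "q ^ 2 * phi (q * x) = q * (q * phi (q * x) - - (h * x)) - h * q * x"
    by (simp add: power2_eq_square algebra_simps)
  then show ?thesis using q_phi[of x] hq by (simp add: cong_iff_dvd_diff)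
qed

lemma pow_defect_mult_q: "[pow_defect q (q * x) = - (h * (1 + 2 * d) * x)] (mod N)"
proof -
  have "pow_defect q (q * x) - - (h * (1 + 2 * d) * x) = (q * phi (q * x) - - (h * x))
      - q ^ 2 * phi (q * x) - (q ^ 2 * varphi (q * x) - 2 * h * d * x)"
    unfolding pow_defect_def by (simp add: algebra_simps)
  then show ?thesis using q_phi[of x] q2_varphi[of x] N_dvd_q2_phi[of x] by (simp add: cong_iff_dvd_diff)
qed

text \<open>The exponent relating \<open>A\<close> to \<open>B\<close> in \<open>A_pow_defect_eq_B\<close>; the assumption \<open>ex_unit\<close> on \<open>1 - 2 d\<close>
  serves to replace it by \<open>h\<close>.\<close>

lemma pow_defect_one_plus_q: "[pow_defect q (1 + q) = h * (1 - 2 * d)] (mod N)"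
proof -
  have "pow_defect q (1 + q) - h * (1 - 2 * d) = (q * phi (q * 1) - - (h * 1)) + (q ^ 2 - 2 * h)
      - 2 * (q ^ 2 * phi (q * 1)) - q ^ 3 - (q ^ 2 * varphi (q * 1) - 2 * h * d * 1)"
    unfolding pow_defect_def add.commute[of 1 q] phi_Suc varphi_Suc
    by (simp add: algebra_simps power2_eq_square power3_eq_cube)
  moreover have "N dvd \<dots>"
    using q_phi[of 1] q2_varphi[of 1] N_dvd_q2_phi[of 1] q2 N_dvd_q3 unfolding cong_iff_dvd_diff
    by (simp only: dvd_add dvd_diff dvd_mult)
  ultimately show ?thesis by (simp add: cong_iff_dvd_diff)
qed

lemma pow_defect_mult_conj_exp: "[pow_defect q n * conj_exp q (q * m) = pow_defect q n] (mod N)"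
proof -
  have "pow_defect q n * conj_exp q (q * m) - pow_defect q n = (phi n - q * (phi n + varphi n)) * m * q ^ 3
      + (phi n - q * (phi n + varphi n)) * q * (q ^ 2 * phi (q * m))"
    unfolding pow_defect_def conj_exp_def by (simp add: algebra_simps power2_eq_square power3_eq_cube)
  then show ?thesis using N_dvd_q3 N_dvd_q2_phi[of m] by (simp add: cong_iff_dvd_diff)
qed

lemma h_mult_conj_exp: "[h * i * conj_exp q n = h * i] (mod N)"
proof -
  have "h * i * conj_exp q n - h * i = (h * q) * (i * (n + phi n * q))"
    unfolding conj_exp_def by (simp add: algebra_simps power2_eq_square)
  then show ?thesis using hq by (simp add: cong_iff_dvd_diff)
qed

lemma C [simp]: "C \<in> carrier G"
  by (simp add: C_def)

lemma A_cong: "[i = j] (mod N) \<Longrightarrow> A [^] i = A [^] j"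
  by (rule int_pow_cong[OF A A_exp])

lemma B_cong: "[i = j] (mod N) \<Longrightarrow> B [^] i = B [^] j"
  by (rule int_pow_cong[OF B B_exp])

lemma C_A_swap: "C [^] n \<otimes> A [^] t = A [^] (t * conj_exp q (- n)) \<otimes> C [^] n" (is "?l = ?r")
proof -
  have "C [^] n \<otimes> (A [^] t \<otimes> C [^] (- n)) = A [^] (t * conj_exp q (- n))"
    unfolding int_pow_swap[OF A C A_exp N_dvd_q3 A_conj] by (simp add: int_pow_neg cancel_inv)
  then have "C [^] n \<otimes> A [^] t \<otimes> C [^] (- n) \<otimes> C [^] n = ?r" by (simp add: m_assoc)
  then show ?thesis by (simp add: int_pow_neg m_assoc)
qed

lemma C_B_swap: "C [^] n \<otimes> B [^] t = B [^] (t * conj_exp q n) \<otimes> C [^] n" (is "?l = ?r")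
proof -
  have conj: "inv (inv C) \<otimes> B \<otimes> inv C = B [^] (1 + q)" using B_conj by simp
  have "inv C [^] (- n) = C [^] n" by (simp add: int_pow_inv int_pow_neg)
  moreover have "inv C [^] n = inv (C [^] n)" by (simp add: int_pow_inv)
  ultimately have "B [^] t \<otimes> inv (C [^] n) = inv (C [^] n) \<otimes> B [^] (t * conj_exp q n)"
    using int_pow_swap[OF B _ B_exp N_dvd_q3 conj, of t n] by simp
  then have "C [^] n \<otimes> (B [^] t \<otimes> inv (C [^] n)) \<otimes> C [^] n = ?r"
    by (simp add: cancel_inv)
  then show ?thesis by (simp add: m_assoc)
qed

lemma A_pow_B: "A [^] n \<otimes> B = B \<otimes> (A [^] (n - pow_defect q n) \<otimes> C [^] n)"
proof -
  have "A \<otimes> C = inv B \<otimes> A \<otimes> B" by (simp add: C_def m_assoc cancel_inv)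
  moreover have "(inv B \<otimes> A \<otimes> B) [^] n = inv B \<otimes> A [^] n \<otimes> B"
    by (simp add: conj_int_pow)
  moreover have "(A \<otimes> C) [^] n = A [^] (n - pow_defect q n) \<otimes> C [^] n"
    using C_A_swap[of _ 1] by (intro int_pow_mult_swap) auto
  ultimately have "B \<otimes> (inv B \<otimes> A [^] n \<otimes> B) = B \<otimes> (A [^] (n - pow_defect q n) \<otimes> C [^] n)" by simp
  then show ?thesis by (simp add: m_assoc cancel_inv)
qed

lemma B_pow_A: "B [^] n \<otimes> A = A \<otimes> (B [^] (n - pow_defect q n) \<otimes> C [^] (- n))"
proof -
  have "B \<otimes> inv C = inv A \<otimes> B \<otimes> A" by (simp add: C_def m_assoc cancel_inv inv_mult_group)
  moreover have "(inv A \<otimes> B \<otimes> A) [^] n = inv A \<otimes> B [^] n \<otimes> A"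
    by (simp add: conj_int_pow)
  moreover have "(B \<otimes> inv C) [^] n = B [^] (n - pow_defect q n) \<otimes> inv C [^] n"
    using C_B_swap[of "- k" 1 for k]
    by (intro int_pow_mult_swap) (auto simp: int_pow_inv int_pow_neg)
  ultimately have "A \<otimes> (inv A \<otimes> B [^] n \<otimes> A) = A \<otimes> (B [^] (n - pow_defect q n) \<otimes> C [^] (- n))"
    by (simp add: int_pow_inv int_pow_neg)
  then show ?thesis by (simp add: m_assoc cancel_inv)
qed

lemma A_mult_B_pow: "A \<otimes> B [^] n = B [^] n \<otimes> (A \<otimes> (C [^] n \<otimes> B [^] pow_defect q n))"
proof -
  have "B [^] n \<otimes> (A \<otimes> (C [^] n \<otimes> B [^] pow_defect q n)) =
      A \<otimes> (B [^] (n - pow_defect q n) \<otimes> (C [^] (- n) \<otimes> (C [^] n \<otimes> B [^] pow_defect q n)))"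
    using B_pow_A[of n] by (subst mult_eq_left_assoc[OF B_pow_A]) (simp_all add: m_assoc)
  also have "\<dots> = A \<otimes> (B [^] (n - pow_defect q n) \<otimes> B [^] pow_defect q n)"
    by (simp add: int_pow_neg cancel_inv)
  also have "\<dots> = A \<otimes> B [^] n"
    by (simp flip: int_pow_mult)
  finally show ?thesis ..
qed

text \<open>The source of all central elements. The conjugate of \<open>A\<^sup>1\<^sup>+\<^sup>q\<close> by \<open>B\<close> is known from
  \<open>A_pow_B\<close>. It is also the conjugate of \<open>A\<close> by \<open>C B = B\<^sup>1\<^sup>+\<^sup>q C\<close>, which \<open>A_mult_B_pow\<close>
  evaluates. The two results differ by a power of \<open>A\<close> on one side and of \<open>B\<close> on the other.\<close>

lemma A_pow_defect_eq_B: "A [^] (- pow_defect q (1 + q)) = B [^] pow_defect q (1 + q)"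
proof -
  let ?s = "pow_defect q (1 + q)"
  have CB: "C \<otimes> B = B [^] (1 + q) \<otimes> C"
    using B_conj by (metis B C inv_closed int_pow_closed inv_solve_right m_closed)
  have AC: "A \<otimes> C = C \<otimes> A [^] (1 + q)"
    using A_conj by (metis A C cancel_inv(1) m_assoc inv_closed m_closed)
  have C_split: "C [^] (1 + q) = C [^] q \<otimes> C" by (simp add: add.commute[of 1] int_pow_Suc)
  have "C \<otimes> (A [^] (1 + q) \<otimes> B) = A \<otimes> (C \<otimes> B)"
    using AC by (simp flip: m_assoc)
  also have "\<dots> = B [^] (1 + q) \<otimes> (A \<otimes> (C [^] (1 + q) \<otimes> (B [^] ?s \<otimes> C)))"
    unfolding CB by (subst mult_eq_left_assoc[OF A_mult_B_pow]) (simp_all add: m_assoc)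
  also have "\<dots> = B [^] (1 + q) \<otimes> (A \<otimes> (C \<otimes> (C [^] q \<otimes> (B [^] ?s \<otimes> C))))"
    by (simp add: int_pow_mult m_assoc)
  also have "\<dots> = B [^] (1 + q) \<otimes> (C \<otimes> (A [^] (1 + q) \<otimes> (C [^] q \<otimes> (B [^] ?s \<otimes> C))))"
    by (subst mult_eq_left_assoc[OF AC]) simp_all
  also have "\<dots> = C \<otimes> (B \<otimes> (A [^] (1 + q) \<otimes> (C [^] q \<otimes> (B [^] ?s \<otimes> C))))"
    by (subst mult_eq_left_assoc[OF CB[symmetric]]) simp_all
  finally have "A [^] (1 + q) \<otimes> B = B \<otimes> (A [^] (1 + q) \<otimes> (C [^] q \<otimes> (B [^] ?s \<otimes> C)))"
    by simp
  then have "A [^] (1 + q + - ?s) \<otimes> C [^] (1 + q) = A [^] (1 + q) \<otimes> (C [^] q \<otimes> (B [^] ?s \<otimes> C))"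
    unfolding A_pow_B by simp
  then have "A [^] (- ?s) \<otimes> (C [^] q \<otimes> C) = C [^] q \<otimes> (B [^] ?s \<otimes> C)"
    unfolding int_pow_mult[OF A, of "1 + q"] C_split by (simp add: m_assoc)
  then have "A [^] (- ?s) \<otimes> C [^] q = C [^] q \<otimes> B [^] ?s"
    by (simp flip: m_assoc)
  also have "\<dots> = B [^] ?s \<otimes> C [^] q"
    unfolding C_B_swap using B_cong[OF pow_defect_mult_conj_exp[of "1 + q" 1]] by simp
  finally show ?thesis by simp
qed

text \<open>An element that is a power of \<open>A\<close> and a power of \<open>B\<close> commutes with both, so these powers are
  central.\<close>

lemma A_pow_h_eq_B: "A [^] (h * i) = B [^] (- (h * i))"
proof -
  obtain r where r: "[h * (1 - 2 * d) * r = h] (mod N)" using ex_unit by blast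
  have s: "[pow_defect q (1 + q) * (r * j) = h * j] (mod N)" for j
  proof -
    have "[pow_defect q (1 + q) * (r * j) = h * (1 - 2 * d) * (r * j)] (mod N)"
      by (rule cong_scalar_right[OF pow_defect_one_plus_q])
    also have "[h * (1 - 2 * d) * (r * j) = h * j] (mod N)"
      using cong_scalar_right[OF r, of j] by (simp add: mult.assoc)
    finally show ?thesis .
  qed
  have "A [^] (- pow_defect q (1 + q) * (r * - i)) = B [^] (pow_defect q (1 + q) * (r * - i))"
    using A_pow_defect_eq_B int_pow_pow[OF A, of "- pow_defect q (1 + q)" "r * - i"]
      int_pow_pow[OF B, of "pow_defect q (1 + q)" "r * - i"] by (simp only:)
  then show ?thesis
    using A_cong[OF s[of i]] B_cong[OF s[of "- i"]] by simp
qed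

definition central :: "int \<Rightarrow> 'a" where
  "central i = A [^] (h * i)"

lemma central_closed [simp]: "central i \<in> carrier G"
  by (simp add: central_def)

lemma central_mult: "central i \<otimes> central j = central (i + j)"
  by (simp add: central_def distrib_left int_pow_mult)

lemma central_eq_B: "central i = B [^] (- (h * i))"
  by (simp add: central_def A_pow_h_eq_B)

lemma central_A: "central i \<otimes> A [^] (t :: int) = A [^] t \<otimes> central i"
  unfolding central_def int_pow_mult[OF A, symmetric] by (simp only: add.commute)

lemma central_B: "central i \<otimes> B [^] (t :: int) = B [^] t \<otimes> central i"
  unfolding central_eq_B int_pow_mult[OF B, symmetric] by (simp only: add.commute)

lemma central_C: "central i \<otimes> C [^] (t :: int) = C [^] t \<otimes> central i"
  unfolding central_def C_A_swap using A_cong[OF h_mult_conj_exp[of i "- t"]] by simp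

lemma central_A1: "central i \<otimes> A = A \<otimes> central i"
  using central_A[of i 1] by simp

lemma central_eq_one: "N dvd h * i \<Longrightarrow> central i = \<one>"
  unfolding central_def using A_cong[of "h * i" 0] by (simp add: cong_0_iff)

lemma central_eq: "N dvd h * (i - j) \<Longrightarrow> central i = central j"
  unfolding central_def by (rule A_cong) (simp add: cong_iff_dvd_diff right_diff_distrib)

lemma A_split: "[i = j + h * k] (mod N) \<Longrightarrow> A [^] i = A [^] j \<otimes> central k"
  using A_cong[of i "j + h * k"] by (simp add: central_def int_pow_mult)

lemma B_split: "[i = j - h * k] (mod N) \<Longrightarrow> B [^] i = B [^] j \<otimes> central k"
  using B_cong[of i "j - h * k"] unfolding central_eq_B int_pow_mult[OF B, symmetric] by simp

lemmas central_left = central_A central_B central_C central_A1 central_A[THEN mult_eq_left_assoc] central_B[THEN mult_eq_left_assoc]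
  central_C[THEN mult_eq_left_assoc] central_A1[THEN mult_eq_left_assoc]

lemma central_mult_left: "x \<in> carrier G \<Longrightarrow> central i \<otimes> (central j \<otimes> x) = central (i + j) \<otimes> x"
  by (simp add: central_mult flip: m_assoc)

section \<open>Commutation up to central elements\<close>

text \<open>A commutator of \<open>A\<close> with a power of \<open>B\<^sup>q\<close> is a power of \<open>C\<^sup>q\<close> times a central element, as
  \<open>pow_defect\<close> at multiples of \<open>q\<close> is a multiple of \<open>h\<close>.\<close>

lemma B_pow_q_A: "B [^] (q * y) \<otimes> A = A \<otimes> (B [^] (q * y) \<otimes> (C [^] (- (q * y)) \<otimes> central (- ((1 + 2 * d) * y))))"
proof -
  have "[q * y - pow_defect q (q * y) = q * y - h * (- ((1 + 2 * d) * y))] (mod N)"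
    using cong_diff[OF cong_refl pow_defect_mult_q, of "q * y" y] by (simp add: mult.assoc)
  then show ?thesis unfolding B_pow_A by (subst B_split) (simp_all add: m_assoc central_left)
qed

text \<open>The exponent \<open>q\<^sup>2 x\<close> is a multiple of \<open>2 h\<close> modulo \<open>N\<close>, hence the corresponding power of \<open>B\<close> is
  central; but its commutator with \<open>A\<close> is this power of \<open>C\<close>, by \<open>B_pow_A\<close>.\<close>

lemma C_pow_q2_eq_one: "C [^] (q ^ 2 * x) = \<one>"
proof -
  let ?y = "- (q ^ 2 * x)"
  have y: "[?y = h * (- 2 * x)] (mod N)"
    using cong_scalar_right[OF q2, of "- x"] by (simp add: algebra_simps)
  have "[pow_defect q (q * (q * - x)) = - (h * (1 + 2 * d) * (q * - x))] (mod N)"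
    by (rule pow_defect_mult_q)
  also have "[- (h * (1 + 2 * d) * (q * - x)) = 0] (mod N)"
    using dvd_mult[OF hq, of "(1 + 2 * d) * x"] by (simp add: cong_0_iff mult_ac)
  finally have s: "[pow_defect q ?y = 0] (mod N)" by (simp add: power2_eq_square mult.assoc)
  have "B [^] ?y = central (2 * x)"
    unfolding central_eq_B using B_cong[OF y] by (simp add: mult_ac)
  then have "A \<otimes> B [^] ?y = B [^] ?y \<otimes> A" using central_A1 by simp
  also have "\<dots> = A \<otimes> (B [^] ?y \<otimes> C [^] (- ?y))"
    unfolding B_pow_A using B_cong[OF cong_diff[OF cong_refl s], of ?y] by simp
  finally have "B [^] ?y \<otimes> \<one> = B [^] ?y \<otimes> C [^] (- ?y)" by simp
  then show ?thesis by (simp del: r_one)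
qed

text \<open>Conjugation by \<open>B\<^sup>q\<^sup>y\<close> multiplies \<open>A\<close> by \<open>C\<^sup>q\<^sup>y\<close> and a central factor. In the \<open>n\<close>-th power each
  of the \<open>\<phi>(n)\<close> exchanges of \<open>C\<^sup>q\<^sup>y\<close> with \<open>A\<close> costs a further central factor.\<close>

lemma A_pow_B_q: "A [^] n \<otimes> B [^] (q * y) =
    B [^] (q * y) \<otimes> (A [^] n \<otimes> (C [^] (q * y * n) \<otimes> central ((1 + 2 * d) * y * n - 2 * y * phi n)))"
proof (rule int_eq_by_step[where n = n])
  let ?w = "(1 + 2 * d) * y"
  let ?R = "\<lambda>n. B [^] (q * y) \<otimes> (A [^] n \<otimes> (C [^] (q * y * n) \<otimes> central (?w * n - 2 * y * phi n)))"
  show "A [^] (0 :: int) \<otimes> B [^] (q * y) = ?R 0" by (simp add: central_def)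
  have AB: "A \<otimes> B [^] (q * y) = B [^] (q * y) \<otimes> (A \<otimes> (C [^] (q * y) \<otimes> central ?w))"
  proof -
    have "B [^] pow_defect q (q * y) = central ?w"
      unfolding central_eq_B using B_cong[OF pow_defect_mult_q[of y]] by (simp add: mult.assoc)
    then show ?thesis unfolding A_mult_B_pow by simp
  qed
  fix n :: int
  have "[n * conj_exp q (- (q * y)) = n + h * (- 2 * y * n)] (mod N)"
  proof -
    have "n * conj_exp q (- (q * y)) - (n + h * (- 2 * y * n)) =
       - n * y * (q ^ 2 - 2 * h) + n * (q ^ 2 * phi (q * - y))"
      unfolding conj_exp_def by (simp add: algebra_simps power2_eq_square)
    then show ?thesis using q2 N_dvd_q2_phi[of "- y"] by (simp add: cong_iff_dvd_diff)
  qed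
  then have CA: "C [^] (q * y) \<otimes> A [^] n = A [^] n \<otimes> (C [^] (q * y) \<otimes> central (- 2 * y * n))"
    unfolding C_A_swap by (subst A_split) (simp_all add: m_assoc central_left)
  have "A \<otimes> ?R n = B [^] (q * y) \<otimes> (A \<otimes> (C [^] (q * y) \<otimes> (central ?w \<otimes>
      (A [^] n \<otimes> (C [^] (q * y * n) \<otimes> central (?w * n - 2 * y * phi n))))))"
    by (subst mult_eq_left_assoc[OF AB]) (simp_all add: m_assoc)
  also have "\<dots> = B [^] (q * y) \<otimes> (A \<otimes> (C [^] (q * y) \<otimes> (A [^] n \<otimes> (C [^] (q * y * n) \<otimes>
      central (?w + (?w * n - 2 * y * phi n))))))"
    by (simp add: central_left central_mult)
  also have "\<dots> = B [^] (q * y) \<otimes> (A \<otimes> (A [^] n \<otimes> (C [^] (q * y) \<otimes> (C [^] (q * y * n) \<otimes>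
      central (- 2 * y * n + (?w + (?w * n - 2 * y * phi n)))))))"
    by (subst mult_eq_left_assoc[OF CA]) (simp_all add: m_assoc central_left central_mult)
  also have "- 2 * y * n + (?w + (?w * n - 2 * y * phi n)) = ?w * (n + 1) - 2 * y * phi (n + 1)"
    unfolding phi_Suc by (simp add: algebra_simps)
  also have "B [^] (q * y) \<otimes> (A \<otimes> (A [^] n \<otimes> (C [^] (q * y) \<otimes> (C [^] (q * y * n) \<otimes>
      central (?w * (n + 1) - 2 * y * phi (n + 1)))))) = ?R (n + 1)"
    by (simp add: int_pow_mult distrib_left add.commute[of n] flip: m_assoc)
  finally have R: "?R (n + 1) = A \<otimes> ?R n" ..
  have "A [^] (n + 1) \<otimes> B [^] (q * y) = A \<otimes> (A [^] n \<otimes> B [^] (q * y))"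
    by (simp add: add.commute[of n] int_pow_mult m_assoc)
  then show "(A [^] (n + 1) \<otimes> B [^] (q * y) = ?R (n + 1)) = (A [^] n \<otimes> B [^] (q * y) = ?R n)"
    unfolding R by simp
qed

text \<open>For \<open>n = q x\<close> the corrections in \<open>A_pow_B_q\<close> are of third order, or powers of \<open>C\<close> with exponent
  divisible by \<open>q\<^sup>2\<close>, and vanish.\<close>

lemma A_pow_q_B_pow_q: "A [^] (q * x) \<otimes> B [^] (q * y) = B [^] (q * y) \<otimes> A [^] (q * x)"
proof -
  have "C [^] (q * y * (q * x)) = \<one>"
    using C_pow_q2_eq_one[of "y * x"] by (simp add: power2_eq_square mult_ac)
  moreover have "central ((1 + 2 * d) * y * (q * x) - 2 * y * phi (q * x)) = \<one>"
  proof (rule central_eq_one)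
    have "h * ((1 + 2 * d) * y * (q * x) - 2 * y * phi (q * x)) =
       (h * q) * ((1 + 2 * d) * y * x) - y * (q ^ 2 * phi (q * x)) + y * phi (q * x) * (q ^ 2 - 2 * h)"
      by (simp add: algebra_simps)
    moreover have "N dvd \<dots>"
      using hq q2 N_dvd_q2_phi[of x] by (intro dvd_add dvd_diff) (auto simp: cong_iff_dvd_diff)
    ultimately show "N dvd h * ((1 + 2 * d) * y * (q * x) - 2 * y * phi (q * x))" by simp
  qed
  ultimately show ?thesis unfolding A_pow_B_q by simp
qed

lemma C_pow_q_A_pow_q: "C [^] (q * y) \<otimes> A [^] (q * x) = A [^] (q * x) \<otimes> C [^] (q * y)"
proof -
  have "q * x * conj_exp q (- (q * y)) - q * x = - x * y * q ^ 3 + x * q * (q ^ 2 * phi (q * - y))"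
    unfolding conj_exp_def by (simp add: algebra_simps power2_eq_square power3_eq_cube)
  then have "[q * x * conj_exp q (- (q * y)) = q * x] (mod N)"
    using N_dvd_q3 N_dvd_q2_phi[of "- y"] by (simp add: cong_iff_dvd_diff)
  then show ?thesis unfolding C_A_swap using A_cong by simp
qed

lemma C_pow_A: "C [^] k \<otimes> A = A \<otimes> (A [^] (q * - k) \<otimes> (central (2 * phi (k + 1)) \<otimes> C [^] k))"
proof -
  have "conj_exp q (- k) - (1 + q * - k + h * (2 * phi (k + 1))) = phi (k + 1) * (q ^ 2 - 2 * h)"
    unfolding conj_exp_def phi_minus by (simp add: algebra_simps)
  then have "[conj_exp q (- k) = 1 + q * - k + h * (2 * phi (k + 1))] (mod N)"
    using q2 by (simp add: cong_iff_dvd_diff)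
  then have "A [^] conj_exp q (- k) = A \<otimes> A [^] (q * - k) \<otimes> central (2 * phi (k + 1))"
    using A_split int_pow_mult[OF A, of 1 "q * - k"] by simp
  then show ?thesis using C_A_swap[of k 1] by (simp add: m_assoc)
qed

lemma C_pow_B_pow_q: "C [^] k \<otimes> B [^] (q * f) = B [^] (q * f) \<otimes> (central (- 2 * k * f) \<otimes> C [^] k)"
proof -
  have "q * f * conj_exp q k - (q * f - h * (- 2 * k * f)) = f * k * (q ^ 2 - 2 * h) + phi k * f * q ^ 3"
    unfolding conj_exp_def by (simp add: algebra_simps power2_eq_square power3_eq_cube)
  then have "[q * f * conj_exp q k = q * f - h * (- 2 * k * f)] (mod N)"
    using q2 N_dvd_q3 by (simp add: cong_iff_dvd_diff)
  from B_split[OF this] show ?thesis unfolding C_B_swap by (simp add: m_assoc)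
qed

section \<open>The three commutator identities\<close>

text \<open>Moving \<open>A\<close> to the front past \<open>C\<^sup>k\<close> releases \<open>A\<^sup>-\<^sup>q\<^sup>k\<close>, and past \<open>B\<^sup>q\<^sup>y\<close> it releases \<open>C\<^sup>-\<^sup>q\<^sup>y\<close>. The
  released power of \<open>A\<close> commutes with \<open>B\<^sup>q\<^sup>y\<close> and \<open>C\<^sup>q\<^sup>y\<close>, so only the passage of \<open>B\<^sup>q\<^sup>f\<close> through the
  powers of \<open>C\<close> adds another central factor. The form is general enough to apply to every
  \<open>[A\<^sup>n, B\<^sup>t]\<close>, in which the exponent of \<open>B\<close> is always a multiple of \<open>q\<close>.\<close>

lemma normal_form_step:
  "A [^] i \<otimes> B [^] (q * y) \<otimes> C [^] k \<otimes> central x \<otimes> A \<otimes> (B [^] (q * f) \<otimes> C [^] t \<otimes> central g) =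
   A \<otimes> (A [^] (i - q * k) \<otimes> B [^] (q * (y + f)) \<otimes> C [^] (k - q * y + t) \<otimes>
     central (x + g - (1 + 2 * d) * y + 2 * phi (k + 1) - 2 * k * f))" for i k t :: int
proof -
  let ?D = "B [^] (q * f) \<otimes> (C [^] t \<otimes> central g)"
  let ?w = "- ((1 + 2 * d) * y)" and ?e = "2 * phi (k + 1)"
  have A1: "A [^] i \<otimes> A = A \<otimes> A [^] i"
    using int_pow_mult[OF A, of i 1] int_pow_mult[OF A, of 1 i] by (simp add: add.commute)
  \<comment> \<open>The share of \<open>C\<^sup>-\<^sup>q\<^sup>y\<close> in the cost of moving \<open>B\<^sup>q\<^sup>f\<close> is of third order.\<close>
  have Zq: "central (- 2 * (k - q * y) * f) = central (- 2 * k * f)"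
    using dvd_mult[OF hq, of "2 * y * f"] by (intro central_eq) (simp add: algebra_simps)
  have CC: "C [^] (- (q * y)) \<otimes> (C [^] k \<otimes> u) = C [^] (k - q * y) \<otimes> u" if "u \<in> carrier G" for u
    using that by (simp add: add.commute[of _ k] flip: m_assoc int_pow_mult)
  have "A [^] i \<otimes> B [^] (q * y) \<otimes> C [^] k \<otimes> central x \<otimes> A \<otimes> (B [^] (q * f) \<otimes> C [^] t \<otimes> central g) =
     A [^] i \<otimes> (B [^] (q * y) \<otimes> (C [^] k \<otimes> (A \<otimes> (central x \<otimes> ?D))))"
    by (simp add: m_assoc central_left)
  also have "\<dots> = A [^] i \<otimes> (B [^] (q * y) \<otimes> (A \<otimes> (A [^] (q * - k) \<otimes> (C [^] k \<otimes> (central (?e + x) \<otimes> ?D)))))"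
    by (subst mult_eq_left_assoc[OF C_pow_A]) (simp_all add: m_assoc central_left central_mult_left del: mult_minus_right)
  also have "\<dots> = A [^] i \<otimes> (A \<otimes> (B [^] (q * y) \<otimes> (C [^] (q * - y) \<otimes> (A [^] (q * - k) \<otimes> (C [^] k \<otimes>
      (central (?w + (?e + x)) \<otimes> ?D))))))"
    by (subst mult_eq_left_assoc[OF B_pow_q_A]) (simp_all add: m_assoc central_left central_mult_left)
  also have "\<dots> = A [^] i \<otimes> (A \<otimes> (B [^] (q * y) \<otimes> (A [^] (q * - k) \<otimes> (C [^] (q * - y) \<otimes> (C [^] k \<otimes>
      (central (?w + (?e + x)) \<otimes> ?D))))))"
    by (subst mult_eq_left_assoc[OF C_pow_q_A_pow_q]) simp_all
  also have "\<dots> = A [^] i \<otimes> (A \<otimes> (A [^] (q * - k) \<otimes> (B [^] (q * y) \<otimes> (C [^] (q * - y) \<otimes> (C [^] k \<otimes>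
      (central (?w + (?e + x)) \<otimes> ?D))))))"
    by (subst mult_eq_left_assoc[OF A_pow_q_B_pow_q[symmetric]]) simp_all
  also have "\<dots> = A \<otimes> (A [^] i \<otimes> (A [^] (q * - k) \<otimes> (B [^] (q * y) \<otimes> (C [^] (k - q * y) \<otimes>
      (central (?w + (?e + x)) \<otimes> ?D)))))"
    by (subst mult_eq_left_assoc[OF A1]) (simp_all add: CC)
  also have "\<dots> = A \<otimes> (A [^] i \<otimes> (A [^] (q * - k) \<otimes> (B [^] (q * y) \<otimes> (C [^] (k - q * y) \<otimes>
      (B [^] (q * f) \<otimes> (C [^] t \<otimes> central (?w + (?e + x) + g)))))))"
    by (simp add: central_left central_mult)
  also have "\<dots> = A \<otimes> (A [^] i \<otimes> (A [^] (q * - k) \<otimes> (B [^] (q * y) \<otimes> (B [^] (q * f) \<otimes> (C [^] (k - q * y) \<otimes>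
      (C [^] t \<otimes> central (- 2 * k * f + (?w + (?e + x) + g))))))))"
    by (subst mult_eq_left_assoc[OF C_pow_B_pow_q])
      (simp_all add: m_assoc central_left central_mult Zq[simplified])
  also have "\<dots> = A \<otimes> (A [^] (i - q * k) \<otimes> B [^] (q * (y + f)) \<otimes> C [^] (k - q * y + t) \<otimes>
     central (- 2 * k * f + (?w + (?e + x) + g)))"
    using int_pow_mult[OF A, of i "q * - k"] int_pow_mult[OF B, of "q * y" "q * f"]
      int_pow_mult[OF C, of "k - q * y" t] by (simp add: m_assoc distrib_left)
  also have "- 2 * k * f + (?w + (?e + x) + g) = x + g - (1 + 2 * d) * y + ?e - 2 * k * f" by simp
  finally show ?thesis .
qed

lemma commutator_C_A:
  "commutator G (C [^] n) (A [^] t) = A [^] (- (q * n * t) - q ^ 2 * phi n * t)"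
proof -
  have "A [^] (- t) \<otimes> C [^] n = C [^] n \<otimes> A [^] (- t * conj_exp q n)"
    by (rule int_pow_swap[OF A C A_exp N_dvd_q3 A_conj])
  then have "commutator G (C [^] n) (A [^] t) = A [^] (- t * conj_exp q n) \<otimes> A [^] t"
    by (simp add: commutator_def m_assoc int_pow_neg[symmetric])
      (simp add: int_pow_neg cancel_inv flip: m_assoc)
  also have "\<dots> = A [^] (- t * conj_exp q n + t)"
    by (simp only: int_pow_mult[OF A])
  also have "- t * conj_exp q n + t = - (q * n * t) - q ^ 2 * phi n * t"
    unfolding conj_exp_def by (simp add: algebra_simps)
  finally show ?thesis .
qed

lemma commutator_C_B:
  "commutator G (C [^] n) (B [^] t) = B [^] (q * n * t - q ^ 2 * phi (n + 1) * t)"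
proof -
  have "commutator G (C [^] n) (B [^] t) = C [^] (- n) \<otimes> B [^] (- t) \<otimes> C [^] n \<otimes> B [^] t"
    by (simp add: commutator_def int_pow_neg)
  also have "\<dots> = B [^] (- t * conj_exp q (- n)) \<otimes> B [^] t"
    unfolding C_B_swap by (simp add: m_assoc int_pow_neg cancel_inv)
  also have "\<dots> = B [^] (- t * conj_exp q (- n) + t)"
    by (simp only: int_pow_mult[OF B])
  also have "- t * conj_exp q (- n) + t = q * n * t - q ^ 2 * phi (n + 1) * t"
    unfolding conj_exp_def phi_minus by (simp add: algebra_simps)
  finally show ?thesis .
qed

text \<open>The initial value of the recursion, brought to the shape required by \<open>normal_form_step\<close>.\<close>

lemma commutator_A_B_pow:
  "commutator G A (B [^] t) = B [^] (q * phi t) \<otimes> C [^] t \<otimes> central (- 2 * (2 * varphi t + phi t))"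
proof -
  have "commutator G A (B [^] t) = C [^] t \<otimes> B [^] pow_defect q t"
    unfolding commutator_def using A_mult_B_pow[of t] by (simp add: m_assoc cancel_inv)
  also have "\<dots> = B [^] (pow_defect q t * conj_exp q t) \<otimes> C [^] t" by (rule C_B_swap)
  also have "B [^] (pow_defect q t * conj_exp q t) = B [^] (q * phi t) \<otimes> central (- 2 * (2 * varphi t + phi t))"
  proof (rule B_split)
    have "phi t * t = 3 * varphi t + 2 * phi t"
      using three_varphi[of t] by (simp add: algebra_simps)
    then have "q ^ 2 * (phi t * t) = q ^ 2 * (3 * varphi t + 2 * phi t)" by simp
    then have "pow_defect q t * conj_exp q t - (q * phi t - h * (- 2 * (2 * varphi t + phi t))) =
        (q ^ 2 - 2 * h) * (2 * varphi t + phi t) +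
        q ^ 3 * (phi t * phi t - (phi t + varphi t) * t - (phi t + varphi t) * phi t * q)"
      unfolding pow_defect_def conj_exp_def by (simp add: algebra_simps power2_eq_square power3_eq_cube)
    then show "[pow_defect q t * conj_exp q t = q * phi t - h * (- 2 * (2 * varphi t + phi t))] (mod N)"
      using q2 N_dvd_q3 by (simp add: cong_iff_dvd_diff)
  qed
  finally show ?thesis by (simp add: m_assoc central_left)
qed

text \<open>Both sides satisfy the recursion \<open>A D(n + 1) = D(n) A D(1)\<close> with \<open>D(0) = \<one>\<close>, in which either of
  \<open>D(n)\<close> and \<open>D(n + 1)\<close> determines the other.\<close>

lemma commutator_A_B:
  "commutator G (A [^] n) (B [^] t) = A [^] (- (q * phi n * t)) \<otimes> B [^] (q * n * phi t)
     \<otimes> C [^] (n * t - q * phi n * phi t) \<otimes> A [^] (h * xi_factor d n t)"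
proof (rule int_eq_by_step[where n = n])
  let ?D = "\<lambda>n :: int. commutator G (A [^] n) (B [^] t)"
  let ?R = "\<lambda>n. A [^] (- (q * phi n * t)) \<otimes> B [^] (q * n * phi t)
     \<otimes> C [^] (n * t - q * phi n * phi t) \<otimes> A [^] (h * xi_factor d n t)"
  show "?D 0 = ?R 0" by (simp add: commutator_def xi_factor_def)
  fix n :: int
  let ?k = "n * t - q * phi n * phi t" and ?g = "- 2 * (2 * varphi t + phi t)"
  let ?x = "xi_factor d n t + ?g - (1 + 2 * d) * (n * phi t) + 2 * phi (?k + 1) - 2 * ?k * phi t"
  have k: "phi (?k + 1) = phi (n * t + 1) + phi (q * (- phi n * phi t)) - (n * t + 1) * q * phi n * phi t"
    using phi_add[of "n * t + 1" "q * (- phi n * phi t)"] by (simp add: algebra_simps)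
  have A_part: "A [^] (- (q * phi n * t) - q * ?k) = A [^] (- (q * phi (n + 1) * t)) \<otimes> central (2 * phi n * phi t)"
  proof (rule A_split)
    have "- (q * phi n * t) - q * ?k - (- (q * phi (n + 1) * t) + h * (2 * phi n * phi t)) =
        phi n * phi t * (q ^ 2 - 2 * h)"
      unfolding phi_Suc by (simp add: algebra_simps power2_eq_square)
    then show "[- (q * phi n * t) - q * ?k = - (q * phi (n + 1) * t) + h * (2 * phi n * phi t)] (mod N)"
      using q2 by (simp add: cong_iff_dvd_diff)
  qed
  have central_part: "central ?x \<otimes> central (2 * phi n * phi t) = central (xi_factor d (n + 1) t)"
    unfolding central_mult
  proof (rule central_eq)
    have "h * (?x + 2 * phi n * phi t - xi_factor d (n + 1) t) =
       q ^ 2 * phi (q * (- phi n * phi t)) - (q ^ 2 - 2 * h) * phi (q * (- phi n * phi t))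
       + 2 * phi n * phi t * (phi t - n * t - 1) * (h * q)"
      unfolding xi_factor_Suc k by (simp add: algebra_simps)
    then show "N dvd h * (?x + 2 * phi n * phi t - xi_factor d (n + 1) t)"
      using q2 hq N_dvd_q2_phi[of "- phi n * phi t"] by (simp add: cong_iff_dvd_diff)
  qed
  have C_part: "?k - q * (n * phi t) + t = (n + 1) * t - q * phi (n + 1) * phi t"
    unfolding phi_Suc by (simp add: algebra_simps)
  have B_part: "q * (n * phi t + phi t) = q * (n + 1) * phi t" by (simp add: algebra_simps)
  have collect: "A [^] i \<otimes> central x \<otimes> B [^] j \<otimes> C [^] k \<otimes> central y = A [^] i \<otimes> B [^] j \<otimes> C [^] k \<otimes> (central y \<otimes> central x)"
    for i j k x y :: int
    by (simp add: m_assoc central_left central_mult add.commute)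
  have "?R n \<otimes> A \<otimes> ?D 1 = A \<otimes> (A [^] (- (q * phi n * t) - q * ?k) \<otimes> B [^] (q * (n * phi t + phi t))
     \<otimes> C [^] (?k - q * (n * phi t) + t) \<otimes> central ?x)"
    using normal_form_step[of "- (q * phi n * t)" "n * phi t" ?k "xi_factor d n t" "phi t" t ?g]
    unfolding commutator_A_B_pow[of t] int_pow_1[OF A] central_def[of "xi_factor d n t"] by (simp only: mult.assoc)
  also have "\<dots> = A \<otimes> (A [^] (- (q * phi (n + 1) * t)) \<otimes> B [^] (q * (n + 1) * phi t)
     \<otimes> C [^] ((n + 1) * t - q * phi (n + 1) * phi t) \<otimes> (central ?x \<otimes> central (2 * phi n * phi t)))"
    unfolding A_part B_part C_part collect ..
  also have "\<dots> = A \<otimes> ?R (n + 1)"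
    unfolding central_part unfolding central_def ..
  finally have R: "?R n \<otimes> A \<otimes> ?D 1 = A \<otimes> ?R (n + 1)" .
  have D: "?D n \<otimes> A \<otimes> ?D 1 = A \<otimes> ?D (n + 1)"
    by (simp add: commutator_def int_pow_Suc inv_mult_group m_assoc cancel_inv)
  have closed [simp]: "?D i \<in> carrier G" for i by (simp add: commutator_def)
  have "(?D (n + 1) = ?R (n + 1)) = (A \<otimes> ?D (n + 1) = A \<otimes> ?R (n + 1))" by simp
  also have "\<dots> = (?D n = ?R n)" unfolding D[symmetric] R[symmetric] using closed[of 1] by simp
  finally show "(?D (n + 1) = ?R (n + 1)) = (?D n = ?R n)" .
qed

end

section \<open>The relations hold in the presented group\<close>

lemma presented_group_relation:
  fixes E :: "('a word \<times> 'a word) set"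
  assumes closed: "\<And>u v. (u, v) \<in> E \<Longrightarrow> u \<in> carrier free_group \<and> v \<in> carrier free_group"
    and E: "(u, v) \<in> E"
  shows "normal_closure free_group (relators E) #>\<^bsub>free_group\<^esub> u =
    normal_closure free_group (relators E) #>\<^bsub>free_group\<^esub> v"
proof -
  interpret F: group "free_group :: 'a word monoid" by (rule group_free_group)
  let ?N = "normal_closure free_group (relators E)"
  interpret N: normal ?N "free_group :: 'a word monoid"
    by (rule normal_closure_relators[OF closed])
  have uv: "u \<in> carrier free_group" "v \<in> carrier free_group" using closed[OF E] by auto
  have "u \<otimes>\<^bsub>free_group\<^esub> inv\<^bsub>free_group\<^esub> v \<in> ?N"
    unfolding normal_closure_def relators_def using E by blast
  then have "?N #>\<^bsub>free_group\<^esub> (u \<otimes>\<^bsub>free_group\<^esub> inv\<^bsub>free_group\<^esub> v) = ?N"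
    by (rule N.rcos_const[OF F.is_group])
  then show ?thesis using uv N.subset by (intro F.coset_mult_inv1) auto
qed

lemma J_group_relations:
  fixes p m :: nat and \<alpha> :: int
  defines "J \<equiv> J_group p m \<alpha>" and "A \<equiv> J_A p m \<alpha>" and "B \<equiv> J_B p m \<alpha>" and "C \<equiv> J_C p m \<alpha>"
  shows "A \<in> carrier J" "B \<in> carrier J"
    and "inv\<^bsub>J\<^esub> C \<otimes>\<^bsub>J\<^esub> A \<otimes>\<^bsub>J\<^esub> C = A [^]\<^bsub>J\<^esub> \<alpha>" "C \<otimes>\<^bsub>J\<^esub> B \<otimes>\<^bsub>J\<^esub> inv\<^bsub>J\<^esub> C = B [^]\<^bsub>J\<^esub> \<alpha>"
    and "A [^]\<^bsub>J\<^esub> int (J_exponent p m) = \<one>\<^bsub>J\<^esub>" "B [^]\<^bsub>J\<^esub> int (J_exponent p m) = \<one>\<^bsub>J\<^esub>"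
proof -
  let ?E = "J_relations p m \<alpha>" and ?F = "free_group :: gen word monoid"
  let ?N = "normal_closure ?F (relators ?E)" and ?a = "free_gen GenA" and ?b = "free_gen GenB"
  interpret F: group ?F by (rule group_free_group)
  interpret N: normal ?N ?F by (rule normal_closure_relators[OF J_relations_closed])
  interpret J: group J unfolding J_def by (rule group_J_group)
  have hom: "(\<lambda>w. ?N #>\<^bsub>?F\<^esub> w) \<in> hom ?F J"
    using N.r_coset_hom_Mod by (simp add: J_def J_group_def presented_group_def)
  interpret \<pi>: group_hom ?F J "\<lambda>w. ?N #>\<^bsub>?F\<^esub> w"
    by (rule group_hom.intro[OF F.is_group J.is_group]) (simp add: group_hom_axioms_def hom)
  have gens: "?a \<in> carrier ?F" "?b \<in> carrier ?F" by (rule free_gen_closed)+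
  have AB: "A = ?N #>\<^bsub>?F\<^esub> ?a" "B = ?N #>\<^bsub>?F\<^esub> ?b"
    by (simp_all add: A_def B_def J_A_def J_B_def presented_gen_def)
  show A: "A \<in> carrier J" and B: "B \<in> carrier J"
    unfolding AB using gens by simp_all
  have comm: "commutator J (?N #>\<^bsub>?F\<^esub> u) (?N #>\<^bsub>?F\<^esub> v) = ?N #>\<^bsub>?F\<^esub> commutator ?F u v"
    and conj: "conjugate J (?N #>\<^bsub>?F\<^esub> u) (?N #>\<^bsub>?F\<^esub> v) = ?N #>\<^bsub>?F\<^esub> conjugate ?F u v"
    if "u \<in> carrier ?F" "v \<in> carrier ?F" for u v
    using that by (simp_all add: commutator_def conjugate_def)
  have closed: "commutator ?F u v \<in> carrier ?F" if "u \<in> carrier ?F" "v \<in> carrier ?F" for u v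
    using that by (simp add: commutator_def)
  have C: "C = commutator J A B" by (simp add: C_def J_C_def J_def A_def B_def)
  have rel: "?N #>\<^bsub>?F\<^esub> u = ?N #>\<^bsub>?F\<^esub> v" if "(u, v) \<in> ?E" for u v
    using J_relations_closed that by (rule presented_group_relation)
  have "conjugate J A (commutator J A B) = A [^]\<^bsub>J\<^esub> \<alpha>"
    unfolding AB comm[OF gens] conj[OF gens(1) closed[OF gens]] \<pi>.hom_int_pow[OF gens(1), symmetric]
    by (rule rel) (simp add: J_relations_def Let_def)
  then show "inv\<^bsub>J\<^esub> C \<otimes>\<^bsub>J\<^esub> A \<otimes>\<^bsub>J\<^esub> C = A [^]\<^bsub>J\<^esub> \<alpha>" by (simp add: C conjugate_def)
  have "conjugate J B (commutator J B A) = B [^]\<^bsub>J\<^esub> \<alpha>"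
    unfolding AB comm[OF gens(2,1)] conj[OF gens(2) closed[OF gens(2,1)]]
      \<pi>.hom_int_pow[OF gens(2), symmetric]
    by (rule rel) (simp add: J_relations_def Let_def)
  moreover have "commutator J B A = inv\<^bsub>J\<^esub> C"
    using A B by (simp add: C commutator_def J.inv_mult_group J.m_assoc)
  moreover have "C \<in> carrier J" using A B by (simp add: C commutator_def)
  ultimately show "C \<otimes>\<^bsub>J\<^esub> B \<otimes>\<^bsub>J\<^esub> inv\<^bsub>J\<^esub> C = B [^]\<^bsub>J\<^esub> \<alpha>" by (simp add: conjugate_def)
  show "A [^]\<^bsub>J\<^esub> int (J_exponent p m) = \<one>\<^bsub>J\<^esub>"
    unfolding AB int_pow_int \<pi>.hom_nat_pow[OF gens(1), symmetric] \<pi>.hom_one[symmetric]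
    by (rule rel) (simp add: J_relations_def Let_def)
  show "B [^]\<^bsub>J\<^esub> int (J_exponent p m) = \<one>\<^bsub>J\<^esub>"
    unfolding AB int_pow_int \<pi>.hom_nat_pow[OF gens(2), symmetric] \<pi>.hom_one[symmetric]
    by (rule rel) (simp add: J_relations_def Let_def)
qed

section \<open>Arithmetic of the parameters\<close>

text \<open>This is \<open>\<chi>\<^sub>p q\<^sup>2\<close>. For odd \<open>p\<close> the number \<open>(1 + p\<^sup>m) / 2\<close> is an integer inverse of \<open>2\<close> modulo \<open>p\<^sup>m\<close>,
  which suffices since \<open>N\<close> is \<open>p\<^sup>3\<^sup>m\<close>; for \<open>p = 2\<close> the square itself is even.\<close>

definition half_sq :: "nat \<Rightarrow> nat \<Rightarrow> int \<Rightarrow> int" where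
  "half_sq p m l = (int p ^ m * l) ^ 2 * (if p = 2 then 1 else 1 + int p ^ m) div 2"

text \<open>This is \<open>q / 3\<close> for \<open>p = 3\<close>, and \<open>0\<close> for all other primes.\<close>

definition q_third :: "nat \<Rightarrow> nat \<Rightarrow> int \<Rightarrow> int" where
  "q_third p m l = delta3 p * 3 ^ (m - 1) * l"

lemma two_half_sq:
  assumes "prime p" "m \<ge> 1"
  shows "2 * half_sq p m l = (int p ^ m * l) ^ 2 * (if p = 2 then 1 else 1 + int p ^ m)"
proof -
  have "odd p" if "p \<noteq> 2" using that assms(1) primes_dvd_imp_eq two_is_prime_nat by blast
  then have "even ((int p ^ m * l) ^ 2 * (if p = 2 then 1 else 1 + int p ^ m))"
    using assms(2) by auto
  then show ?thesis unfolding half_sq_def by simp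
qed

lemma floor_xi:
  assumes "prime p" "m \<ge> 1"
  shows "\<lfloor>xi p m l n t\<rfloor> = half_sq p m l * xi_factor (q_third p m l) n t"
proof -
  have "of_int (2 * half_sq p m l) = (2 * of_nat p ^ (2 * m) * of_int l ^ 2 * chi p m :: rat)"
    unfolding two_half_sq[OF assms] chi_def
    by (simp add: power_mult_distrib power_mult[symmetric] mult.commute[of m])
  then have "of_nat p ^ (2 * m) * of_int l ^ 2 * chi p m = (of_int (half_sq p m l) :: rat)" by simp
  then have "xi p m l n t = of_int (half_sq p m l * xi_factor (q_third p m l) n t)"
    unfolding xi_def xi_factor_def q_third_def by (simp add: mult.assoc)
  then show ?thesis by (simp only: floor_of_int)
qed

lemma half_sq_congs_odd:
  fixes p m :: nat and l :: int
  assumes p: "prime p" "p \<noteq> 2" and m: "m \<ge> 1"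
  defines "q \<equiv> int p ^ m * l" and "h \<equiv> half_sq p m l" and "N \<equiv> int (J_exponent p m)"
  shows "[q ^ 2 = 2 * h] (mod N)" "N dvd h * q" "[q * phi (q * x) = - (h * x)] (mod N)"
proof -
  let ?k = "int p ^ m"
  have N: "N = ?k ^ 3"
    using p by (simp add: N_def J_exponent_def power_mult mult.commute[of 3])
  have h: "2 * h = q ^ 2 * (1 + ?k)" unfolding h_def q_def using two_half_sq[OF p(1) m] p(2) by simp
  have "odd p" using p primes_dvd_imp_eq two_is_prime_nat by blast
  then have cancel: "N dvd y" if "N dvd 2 * y" for y
    using that unfolding N by (subst (asm) coprime_dvd_mult_right_iff) auto
  have "q ^ 2 - 2 * h = N * (- (l ^ 2))"
    unfolding h N by (simp add: q_def algebra_simps power2_eq_square power3_eq_cube)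
  then show "[q ^ 2 = 2 * h] (mod N)" by (simp add: cong_iff_dvd_diff)
  have "2 * (h * q) = (2 * h) * q" by simp
  also have "\<dots> = N * (l ^ 3 * (1 + ?k))"
    unfolding h N by (simp add: q_def algebra_simps power2_eq_square power3_eq_cube)
  finally have "N dvd 2 * (h * q)" by simp
  then show "N dvd h * q" by (rule cancel)
  have "2 * (q * phi (q * x) - - (h * x)) = q * (2 * phi (q * x)) + (2 * h) * x"
    by (simp add: algebra_simps)
  also have "\<dots> = N * (l ^ 3 * x ^ 2 + l ^ 2 * x)"
    unfolding two_phi h N by (simp add: q_def algebra_simps power2_eq_square power3_eq_cube)
  finally have "N dvd 2 * (q * phi (q * x) - - (h * x))" by simp
  then show "[q * phi (q * x) = - (h * x)] (mod N)"
    unfolding cong_iff_dvd_diff by (rule cancel)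
qed

text \<open>In terms of \<open>e = 2\<^sup>m\<^sup>-\<^sup>1\<close> the exponent \<open>2\<^sup>3\<^sup>m\<^sup>-\<^sup>1\<close> is \<open>4 e\<^sup>3\<close>, that is, half of \<open>(2 e)\<^sup>3\<close>. This is
  small enough to annihilate half of \<open>q\<^sup>3\<close>, so that division by \<open>2\<close> does no harm.\<close>

lemma half_sq_congs_2:
  fixes m :: nat and l :: int
  assumes m: "m \<ge> 1"
  defines "q \<equiv> int 2 ^ m * l" and "h \<equiv> half_sq 2 m l" and "N \<equiv> int (J_exponent 2 m)"
  shows "[q ^ 2 = 2 * h] (mod N)" "N dvd h * q" "[q * phi (q * x) = - (h * x)] (mod N)"
proof -
  define e :: int where "e = 2 ^ (m - 1)"
  have "(2 :: int) ^ m = 2 * e" unfolding e_def using m by (metis power_Suc Suc_diff_1 less_eq_Suc_le One_nat_def)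
  then have q: "q = 2 * e * l" by (simp add: q_def)
  have "3 * m - 1 = 3 * (m - 1) + 2" using m by simp
  then have N: "N = 4 * e ^ 3" by (simp add: N_def J_exponent_def e_def power_add power_mult mult.commute[of 3])
  have "2 * h = q ^ 2" unfolding h_def q_def using two_half_sq[of 2 m l] m by simp
  then have h: "h = 2 * e ^ 2 * l ^ 2" unfolding q by (simp add: power_mult_distrib)
  show "[q ^ 2 = 2 * h] (mod N)" by (simp add: \<open>2 * h = q ^ 2\<close>)
  have "h * q = N * l ^ 3"
    unfolding h q N by (simp add: algebra_simps power2_eq_square power3_eq_cube)
  then show "N dvd h * q" by simp
  have "2 * (q * phi (q * x) - - (h * x)) = q * (2 * phi (q * x)) + (2 * h) * x"
    by (simp add: algebra_simps)
  also have "\<dots> = 2 * (N * (l ^ 3 * x ^ 2))"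
    unfolding two_phi h N q by (simp add: algebra_simps power2_eq_square power3_eq_cube)
  finally have "q * phi (q * x) - - (h * x) = N * (l ^ 3 * x ^ 2)"
    unfolding mult_cancel_left by simp
  then show "[q * phi (q * x) = - (h * x)] (mod N)"
    by (simp add: cong_iff_dvd_diff)
qed

lemma half_sq_congs:
  fixes p m :: nat and l :: int
  assumes "prime p" "m \<ge> 1"
  defines "q \<equiv> int p ^ m * l" and "h \<equiv> half_sq p m l" and "N \<equiv> int (J_exponent p m)"
  shows "[q ^ 2 = 2 * h] (mod N)" "N dvd h * q" "[q * phi (q * x) = - (h * x)] (mod N)"
  using half_sq_congs_odd[OF assms(1) _ assms(2)] half_sq_congs_2[OF assms(2)]
  unfolding assms(3-5) by (cases "p = 2"; simp)+

text \<open>The cubic term \<open>q\<^sup>2 (q x) (q x - 1) (q x - 2) / 6\<close> has third order in \<open>q\<close>. For \<open>p \<noteq> 3\<close> it vanishes,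
  since \<open>3\<close> is invertible and \<open>q\<^sup>2 \<phi>(q x)\<close> is already zero. For \<open>p = 3\<close> the division by \<open>3\<close> lowers the
  order, and the term \<open>q\<^sup>3 x / 3\<close> survives: this is the origin of \<open>\<delta>\<close> in \<open>\<xi>\<close>.\<close>

lemma varphi_cong:
  fixes p m :: nat and l :: int
  assumes p: "prime p" and m: "m \<ge> 1"
  defines "q \<equiv> int p ^ m * l" and "h \<equiv> half_sq p m l" and "N \<equiv> int (J_exponent p m)"
  shows "[q ^ 2 * varphi (q * x) = 2 * h * q_third p m l * x] (mod N)"
proof -
  note congs = half_sq_congs[OF p m, of l, folded q_def h_def N_def]
  show ?thesis
  proof (cases "p = 3")
    case False
    have "coprime 3 p" using p False primes_coprime[of 3 p] by simp
    then have "coprime (int p) 3"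
      by (metis coprime_commute coprime_int_iff of_nat_numeral)
    then have coprime: "coprime N 3" unfolding N_def J_exponent_def by auto
    have "q * (q * phi (q * x) - - (h * x)) - x * (h * q) = q ^ 2 * phi (q * x)"
      by (simp add: algebra_simps power2_eq_square)
    then have "N dvd q ^ 2 * phi (q * x)"
      using congs(2,3) unfolding cong_iff_dvd_diff by (metis dvd_diff dvd_mult)
    moreover have "3 * (q ^ 2 * varphi (q * x)) = q ^ 2 * phi (q * x) * (q * x - 2)"
      using three_varphi[of "q * x"] by simp
    ultimately have "N dvd 3 * (q ^ 2 * varphi (q * x))" by (simp only: dvd_mult2)
    then have "N dvd q ^ 2 * varphi (q * x)" using coprime by (simp add: coprime_dvd_mult_right_iff)
    then show ?thesis using False by (simp add: q_third_def delta3_def cong_0_iff)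
  next
    case True
    let ?k = "int p ^ m" and ?d = "q_third p m l"
    have N: "N = ?k ^ 3"
      using True by (simp add: N_def J_exponent_def power_mult mult.commute[of 3])
    have h: "2 * h = q ^ 2 * (1 + ?k)" unfolding h_def q_def using two_half_sq[OF p m] True by simp
    have "3 * 3 ^ (m - 1) = (3 :: int) ^ m" using m by (metis power_Suc Suc_diff_1 less_eq_Suc_le One_nat_def)
    then have q3: "q = 3 * ?d" using True by (simp add: q_def q_third_def delta3_def)
    define y where "y = q ^ 2 * (q * x - 1) * (q * x - 2) - 2 * (2 * h)"
    have y: "y = N * (l ^ 3 * x * (q * x - 3) - 2 * l ^ 2)"
      unfolding y_def h N by (simp add: q_def algebra_simps power2_eq_square power3_eq_cube)
    have "3 * (2 * (q ^ 2 * varphi (q * x) - 2 * h * ?d * x)) =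
        q ^ 2 * (6 * varphi (q * x)) - 2 * x * (2 * h) * (3 * ?d)"
      by (simp add: algebra_simps)
    also have "\<dots> = q * (x * y)"
      unfolding six_varphi q3[symmetric] y_def by (simp add: algebra_simps)
    also have "\<dots> = 3 * (?d * (x * y))" by (simp only: q3[symmetric] mult.assoc[symmetric])
    finally have "2 * (q ^ 2 * varphi (q * x) - 2 * h * ?d * x) = y * (?d * x)"
      unfolding mult_cancel_left by (simp add: mult_ac)
    then have "N dvd 2 * (q ^ 2 * varphi (q * x) - 2 * h * ?d * x)" by (simp only: y mult.assoc dvd_triv_left)
    moreover have "coprime N 2" unfolding N using True by simp
    ultimately show ?thesis unfolding cong_iff_dvd_diff by (simp only: coprime_dvd_mult_right_iff)
  qed
qed

text \<open>For \<open>p = 3\<close> the number \<open>1 - 2 d\<close> is prime to \<open>3\<close>: if \<open>m > 1\<close> then \<open>3\<close> divides \<open>d\<close>, and if \<open>m = 1\<close>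
  then \<open>d = l\<close> is \<open>1\<close> modulo \<open>3\<close> by hypothesis. An inverse modulo \<open>3\<^sup>m\<close> is enough because \<open>3\<^sup>2\<^sup>m\<close>
  divides \<open>h\<close>.\<close>

lemma unit_cong:
  fixes p m :: nat and l :: int
  assumes p: "prime p" and m: "m \<ge> 1" and l: "p = 3 \<and> m = 1 \<Longrightarrow> [l = 1] (mod 3)"
  defines "h \<equiv> half_sq p m l" and "N \<equiv> int (J_exponent p m)"
  shows "\<exists>r. [h * (1 - 2 * q_third p m l) * r = h] (mod N)"
proof (cases "p = 3")
  case False
  then show ?thesis by (auto simp: q_third_def delta3_def intro: exI[of _ 1])
next
  case True
  let ?d = "q_third p m l" and ?k = "int p ^ m"
  have N: "N = ?k ^ 3"
    using True by (simp add: N_def J_exponent_def power_mult mult.commute[of 3])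
  have h: "2 * h = (?k * l) ^ 2 * (1 + ?k)" unfolding h_def using two_half_sq[OF p m] True by simp
  have "\<not> 3 dvd 1 - 2 * ?d"
  proof (cases "m = 1")
    case m1: True
    then have "[1 - 2 * ?d = 1 - 2 * 1] (mod 3)"
      using l True by (intro cong_diff cong_mult) (auto simp: q_third_def delta3_def)
    then show ?thesis by (simp add: cong_dvd_iff)
  next
    case False
    then have "3 dvd 2 * ?d" using m True by (simp add: q_third_def delta3_def)
    moreover have "\<not> (3 :: int) dvd (1 - 2 * ?d) + 2 * ?d" by simp
    ultimately show ?thesis using dvd_add by blast
  qed
  then have "coprime 3 (1 - 2 * ?d)" by (intro prime_imp_coprime) auto
  then have "coprime (1 - 2 * ?d) ?k" using True by (simp add: coprime_commute)
  then obtain r where r: "[(1 - 2 * ?d) * r = 1] (mod ?k)" using cong_solve_coprime_int by blast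
  then obtain j where "(1 - 2 * ?d) * r = 1 + ?k * j" by (metis cong_iff_lin cong_sym)
  then have "2 * (h * (1 - 2 * ?d) * r - h) = 2 * h * ?k * j"
    by (simp add: mult.assoc) (simp add: algebra_simps)
  also have "\<dots> = N * (l ^ 2 * (1 + ?k) * j)"
    unfolding h N by (simp add: power_mult_distrib power2_eq_square power3_eq_cube)
  finally have "N dvd 2 * (h * (1 - 2 * ?d) * r - h)" by simp
  moreover have "coprime N 2" unfolding N using True by simp
  ultimately have "[h * (1 - 2 * ?d) * r = h] (mod N)"
    unfolding cong_iff_dvd_diff by (simp only: coprime_dvd_mult_right_iff)
  then show ?thesis by blast
qed

theorem theorem8p1:
  fixes p m :: nat and l \<alpha> n t :: int
    and J :: "gen word set monoid" (structure) and A B C :: "gen word set"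
  assumes "prime p" and "m \<ge> 1" and "\<not> int p dvd l"
    and "p = 3 \<and> m = 1 \<Longrightarrow> [l = 1] (mod 3)"
  defines "\<alpha> \<equiv> 1 + int p ^ m * l"
  defines "J \<equiv> J_group p m \<alpha>"
    and "A \<equiv> J_A p m \<alpha>" and "B \<equiv> J_B p m \<alpha>" and "C \<equiv> J_C p m \<alpha>"
  shows "commutator J (C [^] n) (A [^] t)
        = A [^] (- (int p ^ m * l * n * t) - int p ^ (2 * m) * l ^ 2 * phi n * t)
    \<and> commutator J (C [^] n) (B [^] t)
        = B [^] (int p ^ m * l * n * t - int p ^ (2 * m) * l ^ 2 * phi (n + 1) * t)
    \<and> commutator J (A [^] n) (B [^] t)
        = A [^] (- (int p ^ m * l * phi n * t)) \<otimes> B [^] (int p ^ m * l * n * phi t)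
          \<otimes> C [^] (n * t - int p ^ m * l * phi n * phi t) \<otimes> A [^] \<lfloor>xi p m l n t\<rfloor>"
proof -
  note rels = J_group_relations[of p m \<alpha>, folded J_def A_def B_def C_def]
  interpret J: group J unfolding J_def by (rule group_J_group)
  have C: "C = inv A \<otimes> inv B \<otimes> A \<otimes> B"
    by (simp add: C_def J_C_def commutator_def J_def A_def B_def)
  interpret macdonald_pair J A B C "int p ^ m * l" "int (J_exponent p m)" "half_sq p m l" "q_third p m l"
    using rels half_sq_congs[OF assms(1,2)] varphi_cong[OF assms(1,2)] unit_cong[OF assms(1,2,4)]
    by unfold_locales (simp_all add: C \<alpha>_def)
  have sq: "(int p ^ m * l) ^ 2 = int p ^ (2 * m) * l ^ 2"
    by (simp add: power_mult_distrib power_mult[symmetric] mult.commute)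
  show ?thesis
    unfolding floor_xi[OF assms(1,2)] sq[symmetric]
    by (intro conjI commutator_C_A commutator_C_B commutator_A_B)
qed

end
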